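(* Let $\mathcal{H}\neq\{0\}$ be a complex Hilbert space, let $A$ be a bounded linear operator on $\mathcal{H}$, and let $C(A)=A^*A-AA^*$. Then $A$ is semi-normal if and only if $0$ is an extreme point of the closure $\overline{W(C(A))}$ of the numerical range of $C(A)$.
   Context: For a bounded linear operator $B$ on $\mathcal{H}$, the numerical range is $W(B)=\{\langle Bx,x\rangle : x\in\mathcal{H},\ \|x\|=1\}$. The operator $A$ is called semi-normal if its self-commutator $C(A)=A^*A-AA^*$ is semi-definite, i.e. $C(A)\ge 0$ or $C(A)\le 0$. An extreme point of a convex set $K$ is a point of $K$ that is not in the relative interior of any nondegenerate segment contained in $K$. *)

theory Defs
  imports "HOL-Analysis.Analysis"
begin

(* The real inner product is the real part of the complex one, so the norm, topology and
   positive definiteness are those inherited from real_inner. The complex inner product is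
   linear in its first argument. *)
class complex_inner = real_inner +
  fixes scaleC :: "complex \<Rightarrow> 'a \<Rightarrow> 'a"
    and cinner :: "'a \<Rightarrow> 'a \<Rightarrow> complex"
  assumes scaleC_add_right: "scaleC c (x + y) = scaleC c x + scaleC c y"
    and scaleC_add_left: "scaleC (c + d) x = scaleC c x + scaleC d x"
    and scaleC_scaleC: "scaleC c (scaleC d x) = scaleC (c * d) x"
    and scaleC_of_real: "scaleC (complex_of_real r) x = r *\<^sub>R x"
    and cinner_commute: "cinner x y = cnj (cinner y x)"
    and cinner_add_left: "cinner (x + y) z = cinner x z + cinner y z"
    and cinner_scaleC_left: "cinner (scaleC c x) y = c * cinner x y"
    and inner_eq_Re_cinner: "inner x y = Re (cinner x y)"

class complex_hilbert_space = complex_inner + complete_space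

instantiation complex :: complex_hilbert_space
begin

definition scaleC_complex :: "complex \<Rightarrow> complex \<Rightarrow> complex" where
  "scaleC_complex c x = c * x"

definition cinner_complex :: "complex \<Rightarrow> complex \<Rightarrow> complex" where
  "cinner_complex x y = x * cnj y"

instance
  by standard
    (simp_all add: scaleC_complex_def cinner_complex_def inner_complex_def scaleR_conv_of_real
      algebra_simps)

end

definition bounded_clinear :: "('a::complex_inner \<Rightarrow> 'b::complex_inner) \<Rightarrow> bool" where
  "bounded_clinear T \<longleftrightarrow> bounded_linear T \<and> (\<forall>c x. T (scaleC c x) = scaleC c (T x))"

(* At most one such function exists; for a bounded operator on a Hilbert space there is one,
   by the Riesz representation theorem. *)
definition cadjoint :: "('a::complex_inner \<Rightarrow> 'b::complex_inner) \<Rightarrow> 'b \<Rightarrow> 'a" where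
  "cadjoint T = (THE S. \<forall>x y. cinner (T x) y = cinner x (S y))"

definition self_commutator :: "('a::complex_inner \<Rightarrow> 'a) \<Rightarrow> 'a \<Rightarrow> 'a" where
  "self_commutator A = (\<lambda>x. cadjoint A (A x) - A (cadjoint A x))"

definition numerical_range :: "('a::complex_inner \<Rightarrow> 'a) \<Rightarrow> complex set" where
  "numerical_range B = {cinner (B x) x | x. norm x = 1}"

definition positive_semidefinite :: "('a::complex_inner \<Rightarrow> 'a) \<Rightarrow> bool" where
  "positive_semidefinite T \<longleftrightarrow> (\<forall>x. cinner (T x) x \<in> \<real>\<^sub>\<ge>\<^sub>0)"

definition negative_semidefinite :: "('a::complex_inner \<Rightarrow> 'a) \<Rightarrow> bool" where
  "negative_semidefinite T \<longleftrightarrow> (\<forall>x. cinner (T x) x \<in> \<real>\<^sub>\<le>\<^sub>0)"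

definition semi_normal :: "('a::complex_inner \<Rightarrow> 'a) \<Rightarrow> bool" where
  "semi_normal A \<longleftrightarrow>
    positive_semidefinite (self_commutator A) \<or> negative_semidefinite (self_commutator A)"

end

theory Submission
  imports Defs
begin

text \<open>
  Write \<open>C\<close> for the self-commutator of \<open>A\<close> and \<open>A*\<close> for the adjoint. Everything rests on the identity
  \<open>\<langle>C x, x\<rangle> = \<parallel>A x\<parallel>\<^sup>2 - \<parallel>A* x\<parallel>\<^sup>2\<close> (\<open>cinner_self_commutator\<close>). It shows that the numerical range of
  \<open>C\<close> is a set of real numbers, and that \<open>A\<close> is semi-normal exactly when this set lies on one side
  of \<open>0\<close>.

  If the numerical range has points on both sides of \<open>0\<close>, then \<open>0\<close> lies strictly between them and is
  not an extreme point of the closure. If it lies on one side, then so does its closure, and \<open>0\<close>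
  cannot lie strictly between two points of the closure; what is left is that \<open>0\<close> belongs to the
  closure. Otherwise \<open>\<parallel>A x\<parallel>\<^sup>2\<close> and \<open>\<parallel>A* x\<parallel>\<^sup>2\<close> would differ on the unit sphere by at least some
  \<open>\<delta> > 0\<close>, always in the same direction, and the suprema \<open>\<parallel>A\<parallel>\<^sup>2\<close> and \<open>\<parallel>A*\<parallel>\<^sup>2\<close> would differ by at
  least \<open>\<delta>\<close> too; but an operator and its adjoint have the same norm (\<open>adjoint_pair_no_norm_gap\<close>).

  Since the adjoint is introduced by a definite description, its existence has to be established
  beforehand; this is the Riesz representation theorem.
\<close>

section \<open>Existence of the adjoint\<close>

text \<open>
  The representing vector is the minimizer of \<open>\<parallel>x\<parallel>\<^sup>2 - 2 f x\<close>. The parallelogram law makes every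
  minimizing sequence a Cauchy sequence, and the first variation at the minimum is the claim.
\<close>

lemma riesz_representation:
  fixes f :: "'a::{real_inner, complete_space} \<Rightarrow> real"
  assumes f: "bounded_linear f"
  shows "\<exists>y. \<forall>x. f x = inner x y"
proof -
  interpret f: bounded_linear f by (rule f)
  define \<Phi> where "\<Phi> x = (norm x)\<^sup>2 - 2 * f x" for x
  have lower: "- (onorm f)\<^sup>2 \<le> \<Phi> x" for x
  proof -
    have "f x \<le> onorm f * norm x"
      using onorm[OF f, of x] by simp
    moreover have "0 \<le> (norm x - onorm f)\<^sup>2" by simp
    ultimately show ?thesis
      unfolding \<Phi>_def by (simp add: power2_eq_square algebra_simps)
  qed
  then have bdd: "bdd_below (range \<Phi>)"
    by (auto intro!: bdd_belowI)
  define m where "m = Inf (range \<Phi>)"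
  have m_le: "m \<le> \<Phi> x" for x
    unfolding m_def using bdd by (auto intro: cInf_lower)
  have "\<exists>x. \<Phi> x < m + inverse (real (Suc n))" for n
    using cInf_lessD[of "range \<Phi>" "m + inverse (real (Suc n))"] unfolding m_def by auto
  then obtain u where u: "\<And>n. \<Phi> (u n) < m + inverse (real (Suc n))"
    by metis
  have parallelogram: "(norm (a - b))\<^sup>2 \<le> 2 * (\<Phi> a - m) + 2 * (\<Phi> b - m)" for a b
  proof -
    have "2 * \<Phi> a + 2 * \<Phi> b = 4 * \<Phi> ((1/2) *\<^sub>R (a + b)) + (norm (a - b))\<^sup>2"
      unfolding \<Phi>_def power2_norm_eq_inner f.scaleR f.add
      by (simp add: algebra_simps inner_commute[of b a])
    with m_le[of "(1/2) *\<^sub>R (a + b)"] show ?thesis by simp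
  qed
  have "Cauchy u"
  proof (rule metric_CauchyI)
    fix e :: real
    assume "0 < e"
    then obtain N where N: "inverse (real (Suc N)) < e\<^sup>2 / 4"
      using reals_Archimedean[of "e\<^sup>2 / 4"] by auto
    have near: "\<Phi> (u n) - m < e\<^sup>2 / 4" if "n \<ge> N" for n
    proof -
      have "inverse (real (Suc n)) \<le> inverse (real (Suc N))"
        using that by simp
      with u[of n] N show ?thesis by linarith
    qed
    have "dist (u i) (u j) < e" if "i \<ge> N" "j \<ge> N" for i j
    proof -
      have "(norm (u i - u j))\<^sup>2 < e\<^sup>2"
        using parallelogram[of "u i" "u j"] near[OF that(1)] near[OF that(2)] by (simp add: field_simps)
      then show ?thesis
        using \<open>0 < e\<close> by (simp add: dist_norm power_less_imp_less_base)
    qed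
    then show "\<exists>N. \<forall>i\<ge>N. \<forall>j\<ge>N. dist (u i) (u j) < e" by blast
  qed
  then obtain y where y: "u \<longlonglongrightarrow> y"
    using Cauchy_convergent convergent_def by blast
  have "(\<lambda>n. \<Phi> (u n)) \<longlonglongrightarrow> \<Phi> y"
    unfolding \<Phi>_def by (intro tendsto_intros f.tendsto y)
  moreover have "(\<lambda>n. m + inverse (real (Suc n))) \<longlonglongrightarrow> m + 0"
    by (intro tendsto_intros LIMSEQ_inverse_real_of_nat)
  ultimately have "\<Phi> y \<le> m + 0"
    by (rule LIMSEQ_le) (use u less_imp_le in blast)
  then have min: "\<Phi> y \<le> \<Phi> x" for x
    using m_le[of x] by simp
  have "f x = inner x y" for x
  proof (cases "x = 0")
    case False
    define d where "d = inner x y - f x"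
    \<comment> \<open>\<open>\<Phi> (y + t *\<^sub>R x) - \<Phi> y = t\<^sup>2 * (norm x)\<^sup>2 + 2 * t * d\<close> is smallest at this \<open>t\<close>.\<close>
    define t where "t = - d / (norm x)\<^sup>2"
    have "\<Phi> (y + t *\<^sub>R x) = \<Phi> y + t * (t * (norm x)\<^sup>2) + 2 * t * d"
      unfolding \<Phi>_def d_def power2_norm_eq_inner f.scaleR f.add
      by (simp add: algebra_simps inner_commute[of y x])
    also have "t * (norm x)\<^sup>2 = - d"
      using False by (simp add: t_def)
    finally have "0 \<le> t * d"
      using min[of "y + t *\<^sub>R x"] by (simp add: mult.commute)
    then have "d\<^sup>2 / (norm x)\<^sup>2 \<le> 0"
      by (simp add: t_def power2_eq_square)
    then have "d = 0"
      using False by (simp add: divide_le_0_iff not_less)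
    then show ?thesis by (simp add: d_def)
  qed (simp add: f.zero)
  then show ?thesis by blast
qed

text \<open>
  Real parts suffice to recognize an adjoint: the imaginary part of \<open>cinner x y\<close> is minus the real
  part of \<open>cinner (scaleC \<i> x) y\<close>.
\<close>

lemma cinner_eq_iff_inner_eq:
  assumes "bounded_clinear T"
  shows "(\<forall>x. cinner (T x) y = cinner x z) \<longleftrightarrow> (\<forall>x. inner (T x) y = inner x z)"
proof
  assume eq: "\<forall>x. inner (T x) y = inner x z"
  have Im: "Im (cinner u v) = - inner (scaleC \<i> u) v" for u v :: "'c::complex_inner"
    by (simp add: inner_eq_Re_cinner cinner_scaleC_left)
  have "inner (scaleC \<i> (T x)) y = inner (scaleC \<i> x) z" for x
    using assms eq by (metis bounded_clinear_def)
  with eq show "\<forall>x. cinner (T x) y = cinner x z"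
    by (simp add: complex_eq_iff Im inner_eq_Re_cinner)
qed (simp add: inner_eq_Re_cinner)

lemma cinner_cadjoint:
  fixes T :: "'a::complex_hilbert_space \<Rightarrow> 'b::complex_inner"
  assumes T: "bounded_clinear T"
  shows "cinner (T x) y = cinner x (cadjoint T y)"
proof -
  have "\<exists>z. \<forall>x. inner (T x) y = inner x z" for y
    using T riesz_representation[OF bounded_linear_compose[OF bounded_linear_inner_left]]
    unfolding bounded_clinear_def by blast
  then obtain S where S: "\<forall>x y. cinner (T x) y = cinner x (S y)"
    unfolding cinner_eq_iff_inner_eq[OF T, symmetric] by metis
  have "S' = S" if S': "\<forall>x y. cinner (T x) y = cinner x (S' y)" for S'
  proof
    fix y
    have "inner x (S' y) = inner x (S y)" for x
      using S S' by (simp add: inner_eq_Re_cinner)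
    then show "S' y = S y"
      by (metis vector_eq_rdot inner_commute)
  qed
  with S have "\<forall>x y. cinner (T x) y = cinner x (cadjoint T y)"
    unfolding cadjoint_def by (intro theI[where P = "\<lambda>S. \<forall>x y. cinner (T x) y = cinner x (S y)"]) auto
  then show ?thesis by blast
qed

lemma inner_cadjoint:
  fixes T :: "'a::complex_hilbert_space \<Rightarrow> 'b::complex_inner"
  assumes "bounded_clinear T"
  shows "inner (T x) y = inner x (cadjoint T y)"
  by (simp add: inner_eq_Re_cinner cinner_cadjoint[OF assms])

section \<open>An operator and its adjoint have the same norm\<close>

text \<open>
  Put \<open>x = T y\<close> in the adjoint relation: \<open>\<parallel>T y\<parallel>\<^sup>2 = \<langle>S (T y), y\<rangle> \<le> c \<parallel>T y\<parallel> \<parallel>y\<parallel>\<close>. The adjoint relation is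
  symmetric in \<open>S\<close> and \<open>T\<close>, so bounds can be moved in both directions.
\<close>

lemma adjoint_pair_norm_bound:
  fixes S :: "'a::real_inner \<Rightarrow> 'b::real_inner"
  assumes adj: "\<And>x y. inner (S x) y = inner x (T y)"
    and S: "\<And>x. norm (S x) \<le> c * norm x"
    and "0 \<le> c"
  shows "norm (T y) \<le> c * norm y"
proof (cases "T y = 0")
  case False
  have "norm (T y) * norm (T y) = inner (S (T y)) y"
    by (simp add: adj power2_norm_eq_inner flip: power2_eq_square)
  also have "\<dots> \<le> norm (S (T y)) * norm y"
    by (rule norm_cauchy_schwarz)
  also have "\<dots> \<le> c * norm (T y) * norm y"
    using S by (intro mult_right_mono) auto
  finally have "norm (T y) * norm (T y) \<le> norm (T y) * (c * norm y)"
    by (simp add: ac_simps)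
  with False show ?thesis by simp
qed (simp add: \<open>0 \<le> c\<close>)

lemma adjoint_pair_bounded_linear:
  fixes S :: "'a::real_inner \<Rightarrow> 'b::real_inner"
  assumes S: "bounded_linear S"
    and adj: "\<And>x y. inner (S x) y = inner x (T y)"
  shows "bounded_linear T"
proof (rule bounded_linear_intro)
  have eqI: "u = v" if "\<And>x. inner x u = inner x v" for u v :: 'a
    using that by (metis vector_eq_rdot inner_commute)
  show "T (x + y) = T x + T y" for x y
    by (rule eqI) (simp add: inner_add_right flip: adj)
  show "T (r *\<^sub>R x) = r *\<^sub>R T x" for r x
    by (rule eqI) (simp flip: adj)
  show "norm (T x) \<le> norm x * onorm S" for x
    using adjoint_pair_norm_bound[OF adj, where c = "onorm S"] onorm[OF S] onorm_pos_le[OF S]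
    by (simp add: mult.commute)
qed

text \<open>
  A gap of \<open>\<delta>\<close> on the whole unit sphere would give \<open>\<parallel>T\<parallel>\<^sup>2 \<le> \<parallel>S\<parallel>\<^sup>2 - \<delta>\<close>, and this bound carries over
  from \<open>T\<close> to its adjoint \<open>S\<close>.
\<close>

lemma adjoint_pair_no_norm_gap:
  fixes S :: "'a::real_inner \<Rightarrow> 'a"
  assumes nontrivial: "(UNIV :: 'a set) \<noteq> {0}"
    and S: "bounded_linear S"
    and adj: "\<And>x y. inner (S x) y = inner x (T y)"
    and "0 < \<delta>"
  shows "\<exists>x. norm x = 1 \<and> (norm (S x))\<^sup>2 < (norm (T x))\<^sup>2 + \<delta>"
proof (rule ccontr)
  assume "\<not> ?thesis"
  then have gap: "(norm (T x))\<^sup>2 + \<delta> \<le> (norm (S x))\<^sup>2" if "norm x = 1" for x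
    using that by (auto simp: not_less)
  have T: "bounded_linear T"
    using S adj by (rule adjoint_pair_bounded_linear)
  \<comment> \<open>The bound for the norm of \<open>T\<close> that the gap yields; a unit vector shows that the root is real.\<close>
  define c where "c = sqrt ((onorm S)\<^sup>2 - \<delta>)"
  have sphere: "(norm (T x))\<^sup>2 \<le> (onorm S)\<^sup>2 - \<delta>" if "norm x = 1" for x
  proof -
    have "norm (S x) \<le> onorm S"
      using onorm[OF S, of x] that by simp
    then have "(norm (S x))\<^sup>2 \<le> (onorm S)\<^sup>2"
      by (simp add: power_mono)
    with gap[OF that] show ?thesis by linarith
  qed
  obtain e :: 'a where e: "norm e = 1"
  proof -
    obtain x :: 'a where "x \<noteq> 0"
      using nontrivial by auto
    then have "norm (sgn x) = 1"
      by (simp add: norm_sgn)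
    then show thesis by (rule that)
  qed
  have c: "0 \<le> c" "c\<^sup>2 = (onorm S)\<^sup>2 - \<delta>"
    using order_trans[OF zero_le_power2 sphere[OF e]] by (simp_all add: c_def)
  have "norm (T x) \<le> c * norm x" for x
  proof (cases "x = 0")
    case False
    have "(norm (T (sgn x)))\<^sup>2 \<le> c\<^sup>2"
      using False by (simp add: c sphere norm_sgn)
    then have "norm (T (sgn x)) \<le> c"
      using \<open>0 \<le> c\<close> by (rule power2_le_imp_le)
    then show ?thesis
      using False
      by (simp add: sgn_div_norm linear_cmul[OF bounded_linear.linear[OF T]] field_simps)
  qed (simp add: linear_0[OF bounded_linear.linear[OF T]])
  moreover have "inner (T x) y = inner x (S y)" for x y
    using adj[of y x] by (simp add: inner_commute)
  ultimately have "norm (S x) \<le> c * norm x" for x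
    using adjoint_pair_norm_bound[where S = T and T = S] \<open>0 \<le> c\<close> by blast
  then have "onorm S \<le> c"
    using \<open>0 \<le> c\<close> by (intro onorm_bound)
  then have "(onorm S)\<^sup>2 \<le> c\<^sup>2"
    using onorm_pos_le[OF S] by (rule power_mono)
  with c \<open>0 < \<delta>\<close> show False by simp
qed

section \<open>The quadratic form of the self-commutator\<close>

lemma cinner_self: "cinner x x = complex_of_real ((norm x)\<^sup>2)"
proof -
  have "Im (cinner x x) = 0"
    using arg_cong[OF cinner_commute[of x x], of Im] by simp
  then show ?thesis
    by (simp add: complex_eq_iff power2_norm_eq_inner inner_eq_Re_cinner)
qed

lemma cinner_self_commutator:
  fixes A :: "'a::complex_hilbert_space \<Rightarrow> 'a"
  assumes A: "bounded_clinear A"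
  shows "cinner (self_commutator A x) x
    = complex_of_real ((norm (A x))\<^sup>2 - (norm (cadjoint A x))\<^sup>2)"
proof -
  have "cinner (cadjoint A (A x)) x = cnj (cinner (A x) (A x))"
    by (metis cinner_commute cinner_cadjoint[OF A])
  moreover have "cinner (A (cadjoint A x)) x = cinner (cadjoint A x) (cadjoint A x)"
    by (rule cinner_cadjoint[OF A])
  moreover have "cinner (u - v) w = cinner u w - cinner v w" for u v w :: 'a
    using cinner_add_left[of "u - v" v w] by (simp add: algebra_simps)
  ultimately show ?thesis
    by (simp add: self_commutator_def cinner_self)
qed

lemma semi_normal_iff:
  fixes A :: "'a::complex_hilbert_space \<Rightarrow> 'a"
  assumes "bounded_clinear A"
  shows "semi_normal A \<longleftrightarrow>
    (\<forall>x. norm (cadjoint A x) \<le> norm (A x)) \<or> (\<forall>x. norm (A x) \<le> norm (cadjoint A x))"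
  unfolding semi_normal_def positive_semidefinite_def negative_semidefinite_def
    cinner_self_commutator[OF assms]
  by (simp add: power_mono_iff del: of_real_diff)

text \<open>
  Semi-normality fixes the sign of \<open>\<parallel>A x\<parallel>\<^sup>2 - \<parallel>A* x\<parallel>\<^sup>2\<close>; the unit vector on which this difference is
  below \<open>\<delta>\<close> in absolute value comes from the equality of norms, applied to the pair \<open>(A, A*)\<close> or
  \<open>(A*, A)\<close> according to the sign.
\<close>

lemma zero_in_closure_numerical_range:
  fixes A :: "'a::complex_hilbert_space \<Rightarrow> 'a"
  assumes nontrivial: "(UNIV :: 'a set) \<noteq> {0}"
    and A: "bounded_clinear A"
    and "semi_normal A"
  shows "0 \<in> closure (numerical_range (self_commutator A))"
  unfolding closure_approachable
proof (intro allI impI)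
  fix \<delta> :: real
  assume "0 < \<delta>"
  let ?B = "cadjoint A"
  have lin: "bounded_linear A"
    using A by (simp add: bounded_clinear_def)
  have adj: "inner (A x) y = inner x (?B y)" for x y
    by (rule inner_cadjoint[OF A])
  have adj': "inner (?B x) y = inner x (A y)" for x y
    using adj[of y x] by (simp add: inner_commute)
  have "\<exists>x. norm x = 1 \<and> \<bar>(norm (A x))\<^sup>2 - (norm (?B x))\<^sup>2\<bar> < \<delta>"
    using \<open>semi_normal A\<close> unfolding semi_normal_iff[OF A]
  proof
    assume le: "\<forall>x. norm (?B x) \<le> norm (A x)"
    obtain x where "norm x = 1" "(norm (A x))\<^sup>2 < (norm (?B x))\<^sup>2 + \<delta>"
      using adjoint_pair_no_norm_gap[OF nontrivial lin adj \<open>0 < \<delta>\<close>] by blast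
    moreover have "(norm (?B x))\<^sup>2 \<le> (norm (A x))\<^sup>2"
      using le by (simp add: power_mono)
    ultimately show ?thesis by (intro exI[of _ x]) auto
  next
    assume le: "\<forall>x. norm (A x) \<le> norm (?B x)"
    obtain x where "norm x = 1" "(norm (?B x))\<^sup>2 < (norm (A x))\<^sup>2 + \<delta>"
      using adjoint_pair_no_norm_gap[OF nontrivial adjoint_pair_bounded_linear[OF lin adj] adj' \<open>0 < \<delta>\<close>]
      by blast
    moreover have "(norm (A x))\<^sup>2 \<le> (norm (?B x))\<^sup>2"
      using le by (simp add: power_mono)
    ultimately show ?thesis by (intro exI[of _ x]) auto
  qed
  then obtain x where "norm x = 1" "norm (cinner (self_commutator A x) x) < \<delta>"
    unfolding cinner_self_commutator[OF A] norm_of_real by blast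
  then show "\<exists>z\<in>numerical_range (self_commutator A). dist z 0 < \<delta>"
    by (auto simp: numerical_range_def)
qed

section \<open>Zero as an extreme point of a set of real numbers\<close>

lemma zero_in_open_segment_of_opposite_signs:
  assumes "r < 0" "0 < s"
  shows "0 \<in> open_segment (complex_of_real r) (complex_of_real s)"
proof -
  define u where "u = - r / (s - r)"
  have "0 < u" "u < 1"
    using assms by (auto simp: u_def field_simps)
  moreover have "(1 - u) * r + u * s = 0"
    using assms by (simp add: u_def field_simps)
  then have "(1 - u) *\<^sub>R complex_of_real r + u *\<^sub>R complex_of_real s = 0"
    by (simp add: complex_eq_iff)
  ultimately show ?thesis
    using assms by (auto simp: in_segment)
qed

text \<open>
  On the real line an end point of a set is an extreme point: in \<open>0 = (1 - u) a + u b\<close> with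
  \<open>0 < u < 1\<close> and \<open>a\<close>, \<open>b\<close> of the same sign, both vanish, and an open segment between equal points
  is empty.
\<close>

lemma zero_extreme_point_one_sided:
  fixes K :: "complex set"
  assumes "0 \<in> K" and real: "K \<subseteq> \<real>"
    and side: "(\<forall>z\<in>K. 0 \<le> Re z) \<or> (\<forall>z\<in>K. Re z \<le> 0)"
  shows "0 extreme_point_of K"
  unfolding extreme_point_of_def
proof (intro conjI ballI notI)
  fix a b
  assume ab: "a \<in> K" "b \<in> K" and seg: "0 \<in> open_segment a b"
  then obtain u where u: "0 < u" "u < 1" "0 = (1 - u) *\<^sub>R a + u *\<^sub>R b" and "a \<noteq> b"
    by (auto simp: in_segment)
  have sum: "(1 - u) * Re a + u * Re b = 0"
    using arg_cong[OF u(3), of Re] by simp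
  have "0 \<le> (1 - u) * Re a \<and> 0 \<le> u * Re b \<or> (1 - u) * Re a \<le> 0 \<and> u * Re b \<le> 0"
    using side ab u by (auto simp: mult_nonneg_nonpos)
  with sum have "(1 - u) * Re a = 0" "u * Re b = 0"
    by linarith+
  then have "Re a = Re b"
    using u by simp
  moreover have "Im a = Im b"
    using ab real by (auto simp: subset_iff complex_is_Real_iff)
  ultimately show False
    using \<open>a \<noteq> b\<close> by (simp add: complex_eq_iff)
qed (rule assms)

section \<open>The characterization of semi-normal operators\<close>

theorem proposition2:
  fixes A :: "'a::complex_hilbert_space \<Rightarrow> 'a"
  assumes "(UNIV :: 'a set) \<noteq> {0}"
    and "bounded_clinear A"
  shows "semi_normal A \<longleftrightarrow> 0 extreme_point_of closure (numerical_range (self_commutator A))"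
proof
  let ?W = "numerical_range (self_commutator A)"
  note form = cinner_self_commutator[OF assms(2)]
  assume sn: "semi_normal A"
  have "?W \<subseteq> \<real>"
    by (auto simp: numerical_range_def form simp del: of_real_diff)
  then have "closure ?W \<subseteq> \<real>"
    by (rule closure_minimal) (rule closed_complex_Reals)
  moreover have "(\<forall>z\<in>closure ?W. 0 \<le> Re z) \<or> (\<forall>z\<in>closure ?W. Re z \<le> 0)"
  proof -
    have "?W \<subseteq> {z. 0 \<le> Re z} \<or> ?W \<subseteq> {z. Re z \<le> 0}"
      using sn unfolding semi_normal_iff[OF assms(2)]
      by (auto simp: numerical_range_def form power_mono)
    then have "closure ?W \<subseteq> {z. 0 \<le> Re z} \<or> closure ?W \<subseteq> {z. Re z \<le> 0}"
      by (metis closure_minimal closed_halfspace_Re_ge closed_halfspace_Re_le)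
    then show ?thesis by auto
  qed
  ultimately show "0 extreme_point_of closure ?W"
    using zero_in_closure_numerical_range[OF assms sn] zero_extreme_point_one_sided by blast
next
  let ?W = "numerical_range (self_commutator A)"
  let ?q = "\<lambda>x. (norm (A x))\<^sup>2 - (norm (cadjoint A x))\<^sup>2"
  assume ext: "0 extreme_point_of closure ?W"
  have lin: "bounded_linear A" "bounded_linear (cadjoint A)"
    using assms(2) adjoint_pair_bounded_linear[OF _ inner_cadjoint[OF assms(2)]]
    by (auto simp: bounded_clinear_def)
  have unit: "complex_of_real (?q x / (norm x)\<^sup>2) \<in> ?W" if "x \<noteq> 0" for x
  proof -
    have "?q (sgn x) = ?q x / (norm x)\<^sup>2"
      by (simp add: sgn_div_norm linear_cmul[OF bounded_linear.linear] lin power_mult_distrib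
          power_inverse diff_divide_distrib) (simp add: field_simps)
    moreover have "complex_of_real (?q (sgn x)) \<in> ?W"
      unfolding numerical_range_def
      using that by (auto simp: cinner_self_commutator[OF assms(2)] norm_sgn intro!: exI[of _ "sgn x"])
    ultimately show ?thesis by simp
  qed
  show "semi_normal A"
  proof (rule ccontr)
    assume "\<not> semi_normal A"
    then obtain x y where "norm (A x) < norm (cadjoint A x)" "norm (cadjoint A y) < norm (A y)"
      unfolding semi_normal_iff[OF assms(2)] by (auto simp: not_le)
    then have neg: "?q x < 0" and pos: "0 < ?q y"
      by (auto intro: power_strict_mono)
    have "x \<noteq> 0" "y \<noteq> 0"
      using neg pos linear_0[OF bounded_linear.linear[OF lin(1)]]
        linear_0[OF bounded_linear.linear[OF lin(2)]] by auto
    then have "?q x / (norm x)\<^sup>2 < 0" "0 < ?q y / (norm y)\<^sup>2"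
      using neg pos by (auto intro: divide_neg_pos)
    then have "0 \<in> open_segment (complex_of_real (?q x / (norm x)\<^sup>2))
        (complex_of_real (?q y / (norm y)\<^sup>2))"
      by (rule zero_in_open_segment_of_opposite_signs)
    moreover have "complex_of_real (?q x / (norm x)\<^sup>2) \<in> closure ?W"
      "complex_of_real (?q y / (norm y)\<^sup>2) \<in> closure ?W"
      using unit \<open>x \<noteq> 0\<close> \<open>y \<noteq> 0\<close> closure_subset by blast+
    ultimately show False
      using ext unfolding extreme_point_of_def by blast
  qed
qed

end
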